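(* Let $N\ge 1$ be such that the modular curve $X_0(N)$ has genus $0$ or $1$, let $k\in\mathbb{Z}_{\ge0}$, and let $f(z)=\sum_{n=h}^{\infty}a(n)q^n$ with $q=e^{2\pi i z}$ and $a(h)=1$ be a holomorphic modular form of weight $k$ on $\Gamma_0(N)$, written as $$f(z)=q^h\prod_{m=1}^{\infty}(1-q^m)^{c_f(m)},\qquad c_f(m)\in\mathbb{C}.$$ Let $\mathcal{F}_N$ be a fundamental domain for the action of $\Gamma_0(N)$ on $\mathcal{H}$, and assume the set of roots of $f$ in $\mathcal{F}_N$ is $\{z_j=x_j+iy_j\}_{j=1,\dots,r}$ with $y_1\le\dots\le y_r$ and $r\ge1$. Then $$c_f(m)=\Omega\!\left(\frac{e^{2\pi m y_r}}{m^{3/2}}\right).$$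
   Context: $\Gamma_0(N)$ is the congruence subgroup of $\mathrm{SL}_2(\mathbb{Z})$ of matrices with lower-left entry divisible by $N$, and $X_0(N)=\Gamma_0(N)\backslash(\mathcal{H}\cup\mathbb{P}^1(\mathbb{Q}))$. For functions $F,g$, $F=\Omega(g)$ means there is a positive constant $c$ such that for every $n_0\in\mathbb{N}$ there are infinitely many $n>n_0$ with $F(n)\ge c\cdot g(n)$. *)

theory Defs
  imports
    "HOL-Complex_Analysis.Complex_Analysis"
    "HOL-Homology.Homology"
    "HOL-Algebra.Free_Abelian_Groups"
begin

abbreviation upper_half :: "complex set" where
  "upper_half \<equiv> {z. Im z > 0}"

definition SL2Z :: "(int ^ 2 ^ 2) set" where
  "SL2Z = {A. det A = 1}"

definition Gamma0 :: "nat \<Rightarrow> (int ^ 2 ^ 2) set" where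
  "Gamma0 N = {A \<in> SL2Z. int N dvd A $ 2 $ 1}"

definition aut_factor :: "int ^ 2 ^ 2 \<Rightarrow> complex \<Rightarrow> complex" where
  "aut_factor A z = of_int (A $ 2 $ 1) * z + of_int (A $ 2 $ 2)"

definition mobius :: "int ^ 2 ^ 2 \<Rightarrow> complex \<Rightarrow> complex" where
  "mobius A z = (of_int (A $ 1 $ 1) * z + of_int (A $ 1 $ 2)) / aut_factor A z"


text \<open>
  The extended upper half plane. A point of the Riemann sphere is a value of type
  \<^typ>\<open>complex option\<close>, where \<^term>\<open>None\<close> is the point at infinity.
\<close>

definition ext_upper_half :: "complex option set" where
  "ext_upper_half = Some ` upper_half \<union> (Some \<circ> of_rat) ` (UNIV :: rat set) \<union> {None}"

fun ext_mobius :: "int ^ 2 ^ 2 \<Rightarrow> complex option \<Rightarrow> complex option" where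
  "ext_mobius A None =
     (if A $ 2 $ 1 = 0 then None else Some (of_int (A $ 1 $ 1) / of_int (A $ 2 $ 1)))"
| "ext_mobius A (Some z) = (if aut_factor A z = 0 then None else Some (mobius A z))"

text \<open>
  The usual topology: the neighbourhoods of infinity contain a half plane
  \<open>Im z > Y\<close>, those of a rational number \<open>x\<close> contain an open disc in the upper half
  plane that is tangent to the real axis at \<open>x\<close>.
\<close>

definition ext_upper_half_open :: "complex option set \<Rightarrow> bool" where
  "ext_upper_half_open U \<longleftrightarrow>
     U \<subseteq> ext_upper_half \<and>
     open {z \<in> upper_half. Some z \<in> U} \<and>
     (None \<in> U \<longrightarrow> (\<exists>Y>0. \<forall>z. Im z > Y \<longrightarrow> Some z \<in> U)) \<and>
     (\<forall>x::rat. Some (of_rat x) \<in> U \<longrightarrow>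
        (\<exists>\<rho>>0. \<forall>z \<in> ball (Complex (of_rat x) \<rho>) \<rho>. Some z \<in> U))"

definition ext_upper_half_topology :: "complex option topology" where
  "ext_upper_half_topology = topology ext_upper_half_open"

lemma istopology_ext_upper_half_open: "istopology ext_upper_half_open"
  unfolding istopology_def
proof (intro conjI allI impI)
  fix S T assume S: "ext_upper_half_open S" and T: "ext_upper_half_open T"
  have "open ({z \<in> upper_half. Some z \<in> S} \<inter> {z \<in> upper_half. Some z \<in> T})"
    using S T by (intro open_Int) (auto simp: ext_upper_half_open_def)
  also have "{z \<in> upper_half. Some z \<in> S} \<inter> {z \<in> upper_half. Some z \<in> T} =
      {z \<in> upper_half. Some z \<in> S \<inter> T}"
    by auto
  finally have op: "open {z \<in> upper_half. Some z \<in> S \<inter> T}" .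
  have inf: "\<exists>Y>0. \<forall>z. Im z > Y \<longrightarrow> Some z \<in> S \<inter> T" if None: "None \<in> S \<inter> T"
  proof -
    obtain Y1 where "Y1 > 0" "\<forall>z. Im z > Y1 \<longrightarrow> Some z \<in> S"
      using S None unfolding ext_upper_half_open_def by auto
    moreover obtain Y2 where "Y2 > 0" "\<forall>z. Im z > Y2 \<longrightarrow> Some z \<in> T"
      using T None unfolding ext_upper_half_open_def by auto
    ultimately show ?thesis by (intro exI[of _ "max Y1 Y2"]) auto
  qed
  have cusp: "\<exists>\<rho>>0. \<forall>z \<in> ball (Complex (of_rat x) \<rho>) \<rho>. Some z \<in> S \<inter> T"
    if x: "Some (of_rat x) \<in> S \<inter> T" for x
  proof -
    obtain r where r: "r > 0" "\<forall>z \<in> ball (Complex (of_rat x) r) r. Some z \<in> S"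
      using S x unfolding ext_upper_half_open_def by (meson IntD1)
    obtain s where s: "s > 0" "\<forall>z \<in> ball (Complex (of_rat x) s) s. Some z \<in> T"
      using T x unfolding ext_upper_half_open_def by (meson IntD2)
    have sub: "ball (Complex (of_rat x) a) a \<subseteq> ball (Complex (of_rat x) b) b"
      if "a \<le> b" for a b :: real
    proof
      fix z assume "z \<in> ball (Complex (of_rat x) a) a"
      moreover have "dist (Complex (of_rat x) b) (Complex (of_rat x) a) = b - a"
        using that by (simp add: dist_norm cmod_def)
      ultimately show "z \<in> ball (Complex (of_rat x) b) b"
        using dist_triangle[of "Complex (of_rat x) b" z "Complex (of_rat x) a"] by simp
    qed
    show ?thesis
      using r s sub[of "min r s" r] sub[of "min r s" s]
      by (intro exI[of _ "min r s"]) auto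
  qed
  show "ext_upper_half_open (S \<inter> T)"
    unfolding ext_upper_half_open_def
    using S op inf cusp by (auto simp: ext_upper_half_open_def)
next
  fix K assume K: "\<forall>S\<in>K. ext_upper_half_open S"
  have "open (\<Union>S\<in>K. {z \<in> upper_half. Some z \<in> S})"
    using K by (intro open_UN) (auto simp: ext_upper_half_open_def)
  also have "(\<Union>S\<in>K. {z \<in> upper_half. Some z \<in> S}) = {z \<in> upper_half. Some z \<in> \<Union>K}"
    by auto
  finally have op: "open {z \<in> upper_half. Some z \<in> \<Union>K}" .
  show "ext_upper_half_open (\<Union>K)"
    unfolding ext_upper_half_open_def
  proof (intro conjI allI impI)
    show "\<Union>K \<subseteq> ext_upper_half" using K by (auto simp: ext_upper_half_open_def)
    show "open {z \<in> upper_half. Some z \<in> \<Union>K}" by (fact op)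
  next
    assume "None \<in> \<Union>K"
    then obtain S where "S \<in> K" "None \<in> S" by blast
    then show "\<exists>Y>0. \<forall>z. Im z > Y \<longrightarrow> Some z \<in> \<Union>K"
      using K unfolding ext_upper_half_open_def by (meson UnionI)
  next
    fix x :: rat assume "Some (of_rat x) \<in> \<Union>K"
    then obtain S where "S \<in> K" "Some (of_rat x) \<in> S" by blast
    then show "\<exists>\<rho>>0. \<forall>z \<in> ball (Complex (of_rat x) \<rho>) \<rho>. Some z \<in> \<Union>K"
      using K unfolding ext_upper_half_open_def by (meson UnionI)
  qed
qed

lemma openin_ext_upper_half_topology:
  "openin ext_upper_half_topology U \<longleftrightarrow> ext_upper_half_open U"
  by (simp add: ext_upper_half_topology_def istopology_ext_upper_half_open topology_inverse')


definition Gamma0_orbit :: "nat \<Rightarrow> complex option \<Rightarrow> complex option set" where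
  "Gamma0_orbit N p = (\<lambda>A. ext_mobius A p) ` Gamma0 N"

text \<open>The modular curve, as a set of orbits with the quotient topology.\<close>

definition X0 :: "nat \<Rightarrow> complex option set topology" where
  "X0 N = topology (\<lambda>U. U \<subseteq> Gamma0_orbit N ` ext_upper_half \<and>
      openin ext_upper_half_topology {p \<in> ext_upper_half. Gamma0_orbit N p \<in> U})"

lemma openin_X0:
  "openin (X0 N) U \<longleftrightarrow> U \<subseteq> Gamma0_orbit N ` ext_upper_half \<and>
      openin ext_upper_half_topology {p \<in> ext_upper_half. Gamma0_orbit N p \<in> U}"
proof -
  let ?P = "\<lambda>U. {p \<in> ext_upper_half. Gamma0_orbit N p \<in> U}"
  have Int: "?P (S \<inter> T) = ?P S \<inter> ?P T" for S T by auto
  have Un: "?P (\<Union>K) = (\<Union>S\<in>K. ?P S)" for K by auto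
  have "istopology (\<lambda>U. U \<subseteq> Gamma0_orbit N ` ext_upper_half \<and>
      openin ext_upper_half_topology (?P U))"
    unfolding istopology_def Int Un by (auto intro!: openin_Int openin_Union)
  then show ?thesis by (simp add: X0_def topology_inverse')
qed

text \<open>
  The genus of a closed orientable surface is \<open>g\<close> iff its first integral homology
  group is free abelian of rank \<open>2 g\<close>.
\<close>

definition has_genus :: "'a topology \<Rightarrow> nat \<Rightarrow> bool" where
  "has_genus X g \<longleftrightarrow> homology_group 1 X \<cong> free_Abelian_group {..<2 * g}"


text \<open>
  Holomorphy at the cusps: for every \<open>A\<close> in \<open>SL\<^sub>2(\<int>)\<close>, the function \<open>f|\<^sub>k A\<close> has an
  expansion in nonnegative powers of \<open>exp (2 \<pi> \<i> z / N)\<close>.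
\<close>

definition modular_form :: "nat \<Rightarrow> nat \<Rightarrow> (complex \<Rightarrow> complex) \<Rightarrow> bool" where
  "modular_form k N f \<longleftrightarrow>
     f holomorphic_on upper_half \<and>
     (\<forall>A \<in> Gamma0 N. \<forall>z \<in> upper_half. f (mobius A z) = aut_factor A z ^ k * f z) \<and>
     (\<forall>A \<in> SL2Z. \<exists>b. \<forall>z \<in> upper_half.
        (\<lambda>n. b n * exp (2 * of_real pi * \<i> * z / of_nat N) ^ n) sums
          (f (mobius A z) / aut_factor A z ^ k))"

text \<open>
  Every orbit meets the domain, and two distinct points of the domain can only be
  equivalent if both are boundary points. This covers exact systems of representatives
  as well as closed domains with identifications along the boundary.
\<close>

definition fundamental_domain :: "nat \<Rightarrow> complex set \<Rightarrow> bool" where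
  "fundamental_domain N F \<longleftrightarrow>
     F \<subseteq> upper_half \<and>
     (\<forall>z \<in> upper_half. \<exists>A \<in> Gamma0 N. mobius A z \<in> F) \<and>
     (\<forall>z \<in> F. \<forall>A \<in> Gamma0 N. mobius A z \<in> F \<longrightarrow> mobius A z \<noteq> z \<longrightarrow>
        z \<in> frontier F \<and> mobius A z \<in> frontier F)"

text \<open>
  \<open>(1 - q\<^sup>m)\<^sup>c\<close> as a power series in \<open>q\<close> (for \<open>m > 0\<close>), by the binomial series. The product
  expansion of \<open>f\<close> is an identity of power series in \<open>q\<close>: the exponents are in general not
  integers, and the product does not converge beyond the zero of \<open>f\<close> nearest to \<open>q = 0\<close>.
\<close>

definition euler_factor :: "nat \<Rightarrow> complex \<Rightarrow> complex fps" where
  "euler_factor m c = fps_compose (fps_binomial c) (- (fps_X ^ m))"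

text \<open>
  Unlike \<^const>\<open>bigomega\<close>, this only asks for infinitely many indices.
\<close>

definition Omega_inf :: "(nat \<Rightarrow> real) \<Rightarrow> (nat \<Rightarrow> real) \<Rightarrow> bool" where
  "Omega_inf F g \<longleftrightarrow> (\<exists>c>0. \<forall>n\<^sub>0. infinite {n. n > n\<^sub>0 \<and> F n \<ge> c * g n})"

end

theory Submission
  imports Defs
begin

text \<open>
  Write \<open>f = q\<^sup>h G(q)\<close>. Taking the logarithmic derivative of the product gives
  \<open>q G'(q) / G(q) = - (\<Sum>\<^sub>n B(n) q\<^sup>n)\<close> with \<open>B(n) = (\<Sum>\<^sub>d\<^sub>|\<^sub>n d c(d))\<close>. At the zero
  \<open>s = exp (2 \<pi> \<i> z\<^sub>r)\<close> of \<open>G\<close> the left-hand side has a simple pole with nonzero residue, so by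
  an Abelian argument \<open>B(n) s\<^sup>n\<close> cannot tend to \<open>0\<close>. Since the proper divisors contribute
  exponentially less than \<open>d = n\<close>, neither can \<open>n c(n) s\<^sup>n\<close>. Hence
  \<open>c(n) = \<Omega>(exp (2 \<pi> n y\<^sub>r) / n)\<close>, which is stronger than the claim.
\<close>

section \<open>Radial behaviour of power series with null coefficients\<close>

text \<open>Finitely many terms stay bounded and are killed by the factor \<open>1 - t\<close>; the
  remaining coefficients are below \<open>e / 2\<close>, and the geometric series turns them into at
  most \<open>e / 2\<close> after multiplication by \<open>1 - t\<close>. So null coefficients rule
  out growth of order \<open>1 / (1 - t)\<close>, that is, a pole at the end of the radius.\<close>

lemma abel_null_sequence:
  fixes u :: "nat \<Rightarrow> complex"
  assumes "u \<longlonglongrightarrow> 0"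
  shows "((\<lambda>t. of_real (1 - t) * (suminf (\<lambda>n. u n * of_real t ^ n))) \<longlongrightarrow> 0) (at_left (1::real))"
proof (rule tendstoI)
  fix e :: real assume e: "e > 0"
  obtain M where M: "\<And>n. n \<ge> M \<Longrightarrow> norm (u n) < e / 2"
    using LIMSEQ_D[OF assms, of "e / 2"] e by auto
  define K where "K = (\<Sum>n<M. norm (u n))"
  have bound: "norm (of_real (1 - t) * (suminf (\<lambda>n. u n * of_real t ^ n))) \<le> (1 - t) * K + e / 2"
    if t: "0 < t" "t < 1" for t :: real
  proof -
    \<comment> \<open>The geometric term is kept for the indices below \<open>M\<close> as well:
      this only weakens the bound and gives \<open>suminf v\<close> in closed form.\<close>
    define v where "v = (\<lambda>n. (if n < M then norm (u n) else 0) + e / 2 * t ^ n)"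
    have fin: "(\<lambda>n. if n < M then norm (u n) else 0) sums K"
      using sums_If_finite_set[of "{..<M}" "\<lambda>n. norm (u n)"] by (simp add: K_def)
    have geo: "(\<lambda>n. e / 2 * t ^ n) sums (e / 2 * (1 / (1 - t)))"
      using geometric_sums[of t] t by (intro sums_mult) auto
    have v: "v sums (K + e / 2 * (1 / (1 - t)))"
      unfolding v_def by (intro sums_add fin geo)
    have le: "norm (u n * of_real t ^ n) \<le> v n" for n
    proof (cases "n < M")
      case True
      have "norm (u n) * t ^ n \<le> norm (u n) * 1"
        using t by (intro mult_left_mono power_le_one) auto
      then show ?thesis using True t e by (simp add: v_def norm_mult norm_power add_increasing2)
    next
      case False
      then have "norm (u n) * t ^ n \<le> e / 2 * t ^ n"
        using M[of n] t by (intro mult_right_mono) auto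
      then show ?thesis using False t by (simp add: v_def norm_mult norm_power)
    qed
    have "norm (suminf (\<lambda>n. u n * of_real t ^ n)) \<le> suminf v"
      using le v by (intro norm_suminf_le) (auto simp: sums_iff)
    also have "\<dots> = K + e / 2 * (1 / (1 - t))" using v by (simp add: sums_iff)
    finally have "(1 - t) * norm (suminf (\<lambda>n. u n * of_real t ^ n)) \<le> (1 - t) * (K + e / 2 * (1 / (1 - t)))"
      using t by (intro mult_left_mono) auto
    also have "\<dots> = (1 - t) * K + e / 2" using t by (simp add: field_simps)
    finally show ?thesis using t by (simp add: norm_mult flip: of_real_diff)
  qed
  have "((\<lambda>t. (1 - t) * K + e / 2) \<longlongrightarrow> (1 - 1) * K + e / 2) (at_left (1::real))"
    by (intro tendsto_intros)
  then have "\<forall>\<^sub>F t in at_left 1. (1 - t) * K + e / 2 < e"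
    using e by (auto dest: order_tendstoD(2)[where a = e])
  moreover have "\<forall>\<^sub>F t in at_left (1::real). t \<in> {0<..<1}"
    by (intro eventually_at_leftI[of 0]) auto
  ultimately show "\<forall>\<^sub>F t in at_left (1::real).
      dist (of_real (1 - t) * (suminf (\<lambda>n. u n * of_real t ^ n))) 0 < e"
  proof eventually_elim
    case (elim t)
    then show ?case using bound[of t] by (simp add: dist_norm)
  qed
qed

text \<open>Here \<open>B\<close> expands \<open>q g' / g\<close>, which has a simple pole at
  \<open>s\<close> whose residue is \<open>s\<close> times the order of the zero. Null terms
  \<open>B(n) s^n\<close> would make \<open>B\<close> converge up to radius \<open>norm s\<close>
  and, by the Abelian lemma, grow more slowly than such a pole along the radius to \<open>s\<close>.
  All identities are kept free of division by \<open>g\<close>, so zeros of smaller modulus do no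
  harm.\<close>

lemma log_deriv_coeffs_not_null:
  fixes g B :: "complex fps" and s :: complex
  assumes conv: "ereal (norm s) < fps_conv_radius g"
    and s: "s \<noteq> 0" and zero: "eval_fps g s = 0" and g0: "fps_nth g 0 \<noteq> 0"
    and eq: "fps_X * fps_deriv g = B * g"
  shows "\<not> (\<lambda>n. fps_nth B n * s ^ n) \<longlonglongrightarrow> 0"
proof
  assume null: "(\<lambda>n. fps_nth B n * s ^ n) \<longlonglongrightarrow> 0"
  define S where "S = eball (0::complex) (fps_conv_radius g)"
  have "eval_fps g holomorphic_on S" by (auto simp: S_def intro: holomorphic_on_eval_fps)
  moreover have "open S" "connected S" by (auto simp: S_def convex_connected)
  moreover have sS: "s \<in> S" using conv by (simp add: S_def in_eball_iff)
  moreover have "\<not> eval_fps g constant_on S"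
  proof
    assume "eval_fps g constant_on S"
    moreover have "0 \<in> S"
      using le_less_trans[of "ereal 0" "ereal (norm s)"] conv by (simp add: S_def in_eball_iff)
    ultimately have "eval_fps g 0 = eval_fps g s" using sS unfolding constant_on_def by metis
    then show False using g0 zero by (simp add: eval_fps_at_0)
  qed
  ultimately obtain H r n where n: "0 < n" and r: "0 < r" and sub: "ball s r \<subseteq> S"
    and H: "H holomorphic_on ball s r"
    and fac: "\<And>w. w \<in> ball s r \<Longrightarrow> eval_fps g w = (w - s) ^ n * H w"
    and Hnz: "\<And>w. w \<in> ball s r \<Longrightarrow> H w \<noteq> 0"
    using holomorphic_factor_zero_nonconstant[of "eval_fps g" S s] zero by metis
  \<comment> \<open>A null sequence is bounded, so the series has a geometric majorant at every
    point \<open>s * p\<close> with \<open>0 < p < 1\<close>. The midpoint of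
    \<open>R / norm s\<close> and \<open>1\<close> serves as such a \<open>p\<close>, and it lies
    beyond the radius \<open>R\<close> to be reached.\<close>
  have radB: "fps_conv_radius B \<ge> norm s"
    unfolding fps_conv_radius_def
  proof (rule conv_radius_geI_ex)
    fix R assume R: "0 < R" "ereal R < ereal (norm s)"
    have "summable (\<lambda>n. (fps_nth B n * s ^ n) * of_real (R / norm s) ^ n)"
    proof (rule powser_inside)
      show "summable (\<lambda>n. (fps_nth B n * s ^ n) * of_real ((1 + R / norm s) / 2) ^ n)"
      proof -
        obtain K where K: "\<And>n. norm (fps_nth B n * s ^ n) \<le> K"
          using convergent_imp_Bseq[of "\<lambda>n. fps_nth B n * s ^ n"] null
          by (auto simp: convergent_def Bseq_def)
        have lt: "(1 + R / norm s) / 2 < 1" and ge: "(1 + R / norm s) / 2 > 0"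
          using R s by (auto simp: add_pos_pos)
        show ?thesis
        proof (rule summable_comparison_test')
          show "summable (\<lambda>n. K * ((1 + R / norm s) / 2) ^ n)"
            using lt ge by (intro summable_mult summable_geometric) auto
          show "norm (fps_nth B n * s ^ n * of_real ((1 + R / norm s) / 2) ^ n)
              \<le> K * ((1 + R / norm s) / 2) ^ n" if "n \<ge> 0" for n
            using K[of n] ge
            by (simp only: norm_mult[of _ "of_real _ ^ _"] norm_power norm_of_real abs_of_pos)
               (intro mult_right_mono, auto)
        qed
      qed
      show "norm (of_real (R / norm s) :: complex) < norm (of_real ((1 + R / norm s) / 2) :: complex)"
      proof -
        have "\<bar>q\<bar> < \<bar>(1 + q) / 2\<bar>" if "0 < q" "q < 1" for q :: real
          using that by simp
        from this[of "R / norm s"] show ?thesis unfolding norm_of_real using R s by auto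
      qed
    qed
    then have "summable (\<lambda>n. fps_nth B n * (s * of_real (R / norm s)) ^ n)"
      by (simp only: power_mult_distrib mult.assoc)
    moreover have "norm (s * of_real (R / norm s)) = R"
      using R s by (simp add: norm_mult norm_divide)
    ultimately show "\<exists>z. norm z = R \<and> summable (\<lambda>n. fps_nth B n * z ^ n)" by blast
  qed
  \<comment> \<open>Insert \<open>g = (w - s)^n H\<close> into \<open>q g' = B g\<close> and cancel
    \<open>(w - s)^(n - 1)\<close>. The right-hand side stays regular at \<open>s\<close>, with
    value \<open>s * n * H s\<close> there.\<close>
  have key: "(w - s) * eval_fps B w * H w = w * (of_nat n * H w + (w - s) * deriv H w)"
    if w: "w \<in> ball s r" "norm w < norm s" for w
  proof -
    have wS: "w \<in> S" using sub w by blast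
    have ws: "w \<noteq> s" using w by auto
    have rg: "ereal (norm w) < fps_conv_radius g" using wS by (simp add: S_def in_eball_iff)
    have rg': "ereal (norm w) < fps_conv_radius (fps_deriv g)"
      using rg fps_conv_radius_deriv[of g] by (rule less_le_trans)
    have rB: "ereal (norm w) < fps_conv_radius B"
      using w radB by (meson less_ereal.simps(1) less_le_trans)
    have "w * eval_fps (fps_deriv g) w = eval_fps (fps_X * fps_deriv g) w"
      using rg' by (subst eval_fps_mult) auto
    also have "\<dots> = eval_fps B w * eval_fps g w"
      unfolding eq using rB rg by (rule eval_fps_mult)
    finally have 1: "w * eval_fps (fps_deriv g) w = eval_fps B w * eval_fps g w" .
    have Hd: "(H has_field_derivative deriv H w) (at w)"
      using H w(1) by (intro holomorphic_derivI[of H "ball s r"]) auto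
    have Pd: "((\<lambda>w. (w - s) ^ n) has_field_derivative of_nat n * (w - s) ^ (n - 1)) (at w)"
      by (auto intro!: derivative_eq_intros)
    have D: "((\<lambda>w. (w - s) ^ n * H w) has_field_derivative
        (of_nat n * (w - s) ^ (n - 1) * H w + (w - s) ^ n * deriv H w)) (at w)"
      using DERIV_mult[OF Pd Hd] by (simp add: mult.commute)
    have "(eval_fps g has_field_derivative
        (of_nat n * (w - s) ^ (n - 1) * H w + (w - s) ^ n * deriv H w)) (at w)"
      using D by (rule has_field_derivative_transform_within_open[where S = "ball s r"])
        (use w fac in auto)
    moreover have "(eval_fps g has_field_derivative eval_fps (fps_deriv g) w) (at w)"
      using rg by (rule has_field_derivative_eval_fps)
    ultimately have 2: "eval_fps (fps_deriv g) w =
        of_nat n * (w - s) ^ (n - 1) * H w + (w - s) ^ n * deriv H w"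
      by (rule DERIV_unique[rotated])
    have pw: "(w - s) ^ n = (w - s) ^ (n - 1) * (w - s)"
      using n by (metis power_minus_mult)
    have "(w - s) ^ (n - 1) * ((w - s) * eval_fps B w * H w) =
        (w - s) ^ (n - 1) * (w * (of_nat n * H w + (w - s) * deriv H w))"
      using 1 unfolding 2 fac[OF w(1)] pw by (simp add: algebra_simps)
    then show ?thesis using ws by simp
  qed
  let ?w = "\<lambda>t::real. of_real t * s"
  have "(?w \<longlongrightarrow> of_real 1 * s) (at_left 1)" by (intro tendsto_intros)
  then have lim_w: "(?w \<longlongrightarrow> s) (at_left 1)" by simp
  have ev: "\<forall>\<^sub>F t in at_left 1. ?w t \<in> ball s r"
    using lim_w r by (intro topological_tendstoD) auto
  have ev01: "\<forall>\<^sub>F t in at_left (1::real). t \<in> {0<..<1}"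
    by (intro eventually_at_leftI[of 0]) auto
  have cont: "isCont G s" if "G holomorphic_on ball s r" for G
    using holomorphic_on_imp_continuous_on[OF that] r by (simp add: continuous_on_eq_continuous_at)
  have limH: "((\<lambda>t. H (?w t)) \<longlongrightarrow> H s) (at_left 1)"
    by (rule isCont_tendsto_compose[OF cont[OF H] lim_w])
  have limH': "((\<lambda>t. deriv H (?w t)) \<longlongrightarrow> deriv H s) (at_left 1)"
    by (rule isCont_tendsto_compose[OF cont[OF holomorphic_deriv[OF H open_ball]] lim_w])
  have lim1: "((\<lambda>t. ?w t * (of_nat n * H (?w t) + (?w t - s) * deriv H (?w t))) \<longlongrightarrow>
      s * (of_nat n * H s + (s - s) * deriv H s)) (at_left 1)"
    by (intro tendsto_intros lim_w limH limH')
  \<comment> \<open>On the radius \<open>?w t - s = - (1 - t) * s\<close>, so the factor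
    \<open>w - s\<close> in \<open>key\<close> becomes the Abelian weight \<open>1 - t\<close> times
    \<open>- s\<close>.\<close>
  have lim2: "((\<lambda>t. - s * (of_real (1 - t) * (suminf (\<lambda>n. fps_nth B n * s ^ n * of_real t ^ n))) * H (?w t))
      \<longlongrightarrow> - s * 0 * H s) (at_left 1)"
    by (intro tendsto_intros limH abel_null_sequence null)
  have ev_eq: "\<forall>\<^sub>F t in at_left 1.
      - s * (of_real (1 - t) * (suminf (\<lambda>n. fps_nth B n * s ^ n * of_real t ^ n))) * H (?w t) =
      ?w t * (of_nat n * H (?w t) + (?w t - s) * deriv H (?w t))"
    using ev ev01
  proof eventually_elim
    case (elim t)
    have "norm (?w t) < norm s" using elim s by (simp add: norm_mult)
    moreover have "eval_fps B (?w t) = (suminf (\<lambda>n. fps_nth B n * s ^ n * of_real t ^ n))"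
      by (simp add: eval_fps_def power_mult_distrib mult_ac)
    ultimately show ?case
      using key[OF elim(1)] by (simp add: algebra_simps)
  qed
  \<comment> \<open>Both limits belong to the same function of \<open>t\<close>. They give
    \<open>s * n * H s = 0\<close>, although none of the three factors vanishes.\<close>
  have "s * (of_nat n * H s + (s - s) * deriv H s) = - s * 0 * H s"
    using tendsto_unique[OF trivial_limit_at_left_real lim1 Lim_transform_eventually[OF lim2 ev_eq]] .
  then show False using s n Hnz[of s] r by simp
qed

section \<open>Logarithmic derivative of an Euler product\<close>

text \<open>This is the expansion of \<open>q^m / (1 - q^m)\<close>. The condition
  \<open>0 < n\<close> removes the constant term, since \<open>m\<close> divides
  \<open>0\<close>.\<close>

definition divisor_series :: "nat \<Rightarrow> complex fps" where
  "divisor_series m = Abs_fps (\<lambda>n. if 0 < n \<and> m dvd n then 1 else 0)"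

lemma divisor_series_eq:
  assumes "m > 0"
  shows "(1 - fps_X ^ m) * divisor_series m = fps_X ^ m"
proof (rule fps_ext)
  fix n
  have "m dvd n - m \<longleftrightarrow> m dvd n" if "n \<ge> m"
    using that by (simp add: dvd_minus_self)
  then show "fps_nth ((1 - fps_X ^ m) * divisor_series m) n = fps_nth (fps_X ^ m) n"
    using assms
    by (auto simp: divisor_series_def left_diff_distrib fps_X_power_mult_nth fps_X_power_nth
        not_less dest: dvd_imp_le)
qed

text \<open>The binomial series satisfies \<open>(1 + X) b' = c b\<close>. Substituting
  \<open>- X^m\<close> and applying the chain rule gives the claim multiplied by
  \<open>1 - X^m\<close>, a nonzero series that can be cancelled.\<close>

lemma euler_factor_log_deriv:
  assumes m: "m > 0"
  shows "fps_X * fps_deriv (euler_factor m c) =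
    - (fps_const (of_nat m * c) * divisor_series m) * euler_factor m c"
proof -
  let ?b = "fps_binomial c" and ?x = "- (fps_X ^ m) :: complex fps"
  have x0: "fps_nth ?x 0 = 0" using m by simp
  have "fps_deriv ?b * (1 + fps_X) = fps_const c * ?b"
    unfolding fps_binomial_deriv by (simp add: fps_divide_unit mult.assoc inverse_mult_eq_1)
  then have "(fps_deriv ?b * (1 + fps_X)) oo ?x = (fps_const c * ?b) oo ?x" by simp
  then have c1: "(fps_deriv ?b oo ?x) * (1 - fps_X ^ m) = fps_const c * euler_factor m c"
    unfolding euler_factor_def
    by (simp add: fps_compose_mult_distrib[OF x0] fps_compose_add_distrib
        fps_X_fps_compose_startby0[OF x0])
  have c2: "fps_X * fps_deriv ?x = - (fps_const (of_nat m) * fps_X ^ m)"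
    using power_minus_mult[OF m, of "fps_X :: complex fps"]
    by (simp add: fps_deriv_power mult_ac)
  have "(1 - fps_X ^ m) * (fps_X * fps_deriv (euler_factor m c)) =
      ((fps_deriv ?b oo ?x) * (1 - fps_X ^ m)) * (fps_X * fps_deriv ?x)"
    unfolding euler_factor_def fps_compose_deriv[OF x0] by (simp only: mult_ac)
  also have "\<dots> = fps_const c * euler_factor m c * - (fps_const (of_nat m) * fps_X ^ m)"
    unfolding c1 c2 ..
  also have "\<dots> = - (fps_const (of_nat m * c) * ((1 - fps_X ^ m) * divisor_series m)) *
      euler_factor m c"
    unfolding divisor_series_eq[OF m] by (simp add: mult_ac flip: fps_const_mult)
  also have "\<dots> = (1 - fps_X ^ m) *
      (- (fps_const (of_nat m * c) * divisor_series m) * euler_factor m c)"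
    by (simp add: mult_ac)
  finally show ?thesis
  proof (rule mult_left_cancel[THEN iffD1, rotated])
    have "fps_nth (1 - fps_X ^ m :: complex fps) 0 \<noteq> 0" using m by simp
    then show "(1 - fps_X ^ m :: complex fps) \<noteq> 0" by (metis fps_zero_nth)
  qed
qed

lemma fps_log_deriv_prod:
  fixes e l :: "nat \<Rightarrow> complex fps"
  assumes "finite A" and "\<And>i. i \<in> A \<Longrightarrow> fps_X * fps_deriv (e i) = l i * e i"
  shows "fps_X * fps_deriv (\<Prod>i\<in>A. e i) = (\<Sum>i\<in>A. l i) * (\<Prod>i\<in>A. e i)"
  using assms
proof (induction A rule: finite_induct)
  case (insert i A)
  have "fps_X * fps_deriv (\<Prod>i\<in>insert i A. e i) =
      (fps_X * fps_deriv (e i)) * (\<Prod>i\<in>A. e i) + e i * (fps_X * fps_deriv (\<Prod>i\<in>A. e i))"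
    using insert.hyps by (simp add: distrib_left mult_ac)
  also have "\<dots> = l i * e i * (\<Prod>i\<in>A. e i) + e i * ((\<Sum>i\<in>A. l i) * (\<Prod>i\<in>A. e i))"
    using insert.IH insert.prems by simp
  also have "\<dots> = (\<Sum>i\<in>insert i A. l i) * (\<Prod>i\<in>insert i A. e i)"
    using insert.hyps by (simp add: algebra_simps)
  finally show ?case .
qed simp

text \<open>Each coefficient sees only a finite partial product, for which logarithmic derivatives
  add up. Collecting the multiples \<open>d dvd n\<close> from the factors produces the divisor
  sum.\<close>

lemma euler_product_log_deriv:
  assumes "(\<lambda>i. euler_factor (Suc i) (c (Suc i))) has_prod g" and "g \<noteq> 0"
  shows "fps_X * fps_deriv g = Abs_fps (\<lambda>n. - sum (\<lambda>d. of_nat d * c d) {d. d dvd n \<and> 0 < n}) * g"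
    (is "_ = ?B * g")
proof (rule fps_ext)
  fix t
  define P where "P = (\<lambda>n. \<Prod>i\<le>n. euler_factor (Suc i) (c (Suc i)))"
  define L where "L = (\<lambda>n. \<Sum>i\<le>n. - (fps_const (of_nat (Suc i) * c (Suc i)) * divisor_series (Suc i)))"
  \<comment> \<open>\<open>has_prod\<close> also admits products with a zero factor and value
    \<open>0\<close>; \<open>g \<noteq> 0\<close> leaves the case in which the partial products
    converge to \<open>g\<close>.\<close>
  have "P \<longlonglongrightarrow> g"
    using assms unfolding has_prod_def raw_has_prod_def P_def by auto
  then have "\<forall>\<^sub>F n in sequentially. \<forall>j\<in>{..t}. fps_nth (P n) j = fps_nth g j"
    unfolding tendsto_fps_iff by (intro eventually_ball_finite) auto
  then obtain n where n: "n \<ge> t" and Pn: "\<And>j. j \<le> t \<Longrightarrow> fps_nth (P n) j = fps_nth g j"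
    unfolding eventually_sequentially by (metis atMost_iff nle_le)
  \<comment> \<open>A divisor \<open>d\<close> of \<open>j\<close> occurs as \<open>Suc i\<close>;
    since \<open>d \<le> j \<le> t \<le> n\<close>, every divisor is among the factors of
    \<open>P n\<close>.\<close>
  have LB: "fps_nth (L n) j = fps_nth ?B j" if "j \<le> t" for j
  proof (cases "j = 0")
    case False
    have "fps_nth (L n) j = - (\<Sum>i\<le>n. if Suc i dvd j then of_nat (Suc i) * c (Suc i) else 0)"
      unfolding L_def fps_sum_nth sum_negf[symmetric]
      using False by (intro sum.cong) (auto simp: divisor_series_def)
    also have "(\<Sum>i\<le>n. if Suc i dvd j then of_nat (Suc i) * c (Suc i) else 0) =
        sum (\<lambda>i. of_nat (Suc i) * c (Suc i)) {i. i \<le> n \<and> Suc i dvd j}"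
      by (simp add: sum.inter_filter[symmetric])
    also have "\<dots> = sum (\<lambda>d. of_nat d * c d) {d. d dvd j \<and> 0 < j}"
      using False that n
      by (intro sum.reindex_bij_witness[of _ "\<lambda>d. d - 1" Suc])
         (auto dest: dvd_imp_le simp: dvd_pos_nat)
    finally show ?thesis by simp
  qed (simp add: L_def divisor_series_def fps_sum_nth)
  have "fps_X * fps_deriv (P n) = L n * P n"
    unfolding P_def L_def by (intro fps_log_deriv_prod euler_factor_log_deriv) auto
  then have "fps_nth (fps_X * fps_deriv (P n)) t = fps_nth (L n * P n) t" by simp
  moreover have "fps_nth (L n * P n) t = fps_nth (?B * g) t"
    unfolding fps_mult_nth using LB Pn by (intro sum.cong) auto
  \<comment> \<open>The factor \<open>fps_X\<close> undoes the degree shift of the derivative, so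
    agreement up to degree \<open>t\<close> suffices.\<close>
  moreover have "fps_nth (fps_X * fps_deriv (P n)) t = fps_nth (fps_X * fps_deriv g) t"
    using Pn[of t] by (cases t) auto
  ultimately show "fps_nth (fps_X * fps_deriv g) t = fps_nth (?B * g) t" by simp
qed

section \<open>Growth of divisor sums\<close>

text \<open>A proper divisor of \<open>n\<close> is at most \<open>n / 2\<close>, so all of them
  together contribute at most \<open>n * K * x^(n / 2)\<close>, which is negligible against
  \<open>x^n\<close>.\<close>

lemma divisor_sum_null:
  fixes v :: "nat \<Rightarrow> real" and x :: real
  assumes x: "x > 1" and v: "\<And>n. v n \<ge> 0" and lim: "(\<lambda>n. v n / x ^ n) \<longlonglongrightarrow> 0"
  shows "(\<lambda>n. sum v {d. d dvd n \<and> 0 < n} / x ^ n) \<longlonglongrightarrow> 0"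
proof -
  have "Bseq (\<lambda>n. v n / x ^ n)"
    by (rule convergent_imp_Bseq[OF convergentI[OF lim]])
  then have "\<exists>K. \<forall>n. norm (v n / x ^ n) \<le> K" unfolding Bseq_def by blast
  then obtain K where bdd: "\<forall>n. norm (v n / x ^ n) \<le> K" ..
  have K: "v n \<le> K * x ^ n" for n
  proof -
    have "v n / x ^ n \<le> K" using bdd by (simp only: real_norm_def abs_le_iff)
    moreover have "x ^ n > 0" using x by simp
    ultimately show ?thesis by (simp only: pos_divide_le_eq)
  qed
  have K0: "K \<ge> 0" using K[of 0] v[of 0] by simp
  \<comment> \<open>The square root expresses \<open>x^(n / 2)\<close> as \<open>y^n\<close>, also
    for odd \<open>n\<close>.\<close>
  define y where "y = sqrt x"
  have y: "y > 1" "x = y ^ 2" using x by (auto simp: y_def)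
  have bound: "sum v {d. d dvd n \<and> 0 < n} / x ^ n \<le> v n / x ^ n + K * (real n * (1 / y) ^ n)" for n
  proof (cases "n = 0")
    case True
    then show ?thesis using v by simp
  next
    case False
    have fin: "finite {d. d dvd n \<and> 0 < n}" using False by auto
    have eq: "{d. d dvd n \<and> 0 < n} = insert n {d. d dvd n \<and> d < n}"
      using False by (auto dest: dvd_imp_le)
    have "sum v {d. d dvd n \<and> 0 < n} = v n + sum v {d. d dvd n \<and> d < n}"
      unfolding eq using fin[unfolded eq] by (subst sum.insert) auto
    also have "sum v {d. d dvd n \<and> d < n} \<le> sum (\<lambda>d. K * y ^ n) {d. d dvd n \<and> d < n}"
    proof (intro sum_mono)
      fix d assume "d \<in> {d. d dvd n \<and> d < n}"
      then have "d dvd n" "d < n" by simp_all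
      then obtain k where k: "n = d * k" by (elim dvdE)
      have "k \<noteq> 0" "k \<noteq> 1" using k \<open>d < n\<close> by (auto intro!: notI)
      then have "d * 2 \<le> d * k" by (intro mult_le_mono2) simp
      then have "2 * d \<le> n" using k by simp
      then have "y ^ (2 * d) \<le> y ^ n" using y(1) by (intro power_increasing) auto
      then have "x ^ d \<le> y ^ n" unfolding y(2) by (simp only: power_mult)
      then show "v d \<le> K * y ^ n" using K[of d] K0 mult_left_mono[of "x ^ d" "y ^ n" K] by linarith
    qed
    also have "\<dots> = real (card {d. d dvd n \<and> d < n}) * (K * y ^ n)" by simp
    also have "\<dots> \<le> real n * (K * y ^ n)"
    proof (intro mult_right_mono)
      have "card {d. d dvd n \<and> d < n} \<le> card {..<n}" by (intro card_mono) auto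
      then show "real (card {d. d dvd n \<and> d < n}) \<le> real n" by simp
    qed (use K0 y in auto)
    finally have "sum v {d. d dvd n \<and> 0 < n} \<le> v n + real n * (K * y ^ n)" by simp
    then have "sum v {d. d dvd n \<and> 0 < n} / x ^ n \<le> (v n + real n * (K * y ^ n)) / x ^ n"
      using x by (intro divide_right_mono) auto
    also have "\<dots> = v n / x ^ n + K * (real n * (1 / y) ^ n)"
      using y by (simp add: power_mult_distrib power2_eq_square add_divide_distrib power_one_over)
    finally show ?thesis .
  qed
  have upper: "(\<lambda>n. v n / x ^ n + K * (real n * (1 / y) ^ n)) \<longlonglongrightarrow> 0"
    using y by (intro tendsto_add_zero lim tendsto_mult_right_zero powser_times_n_limit_0) auto
  show ?thesis
  proof (rule tendsto_sandwich[OF _ _ tendsto_const upper])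
    show "\<forall>\<^sub>F n in sequentially. 0 \<le> sum v {d. d dvd n \<and> 0 < n} / x ^ n"
      using x v by (intro always_eventually allI divide_nonneg_nonneg sum_nonneg) auto
  qed (use bound in simp)
qed

section \<open>The q-expansion and the lower bound\<close>

text \<open>Dividing by \<open>q^h\<close> and shifting the index turns the expansion of
  \<open>f\<close> into a power series with constant term \<open>a h\<close>, to which the Euler
  product applies.\<close>

lemma q_expansion_sums:
  fixes a :: "nat \<Rightarrow> complex"
  assumes "((\<lambda>n. a n * q ^ n) has_sum S) {h..}" and "q \<noteq> 0"
  shows "(\<lambda>n. a (h + n) * q ^ n) sums (S / q ^ h)"
proof -
  have "bij_betw (\<lambda>n. h + n) UNIV {h..}"
    by (rule bij_betwI[of _ _ _ "\<lambda>n. n - h"]) auto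
  then have "((\<lambda>n. a (h + n) * q ^ (h + n)) has_sum S) UNIV"
    using assms(1) by (subst has_sum_reindex_bij_betw[where f = "\<lambda>n. a n * q ^ n"])
  then have "(\<lambda>n. a (h + n) * q ^ (h + n) / q ^ h) sums (S / q ^ h)"
    by (intro sums_divide has_sum_imp_sums)
  moreover have "a (h + n) * q ^ (h + n) / q ^ h = a (h + n) * q ^ n" for n
    using assms(2) by (simp add: power_add)
  ultimately show ?thesis by simp
qed

theorem theorem1p2:
  fixes N k h r :: nat
    and f :: "complex \<Rightarrow> complex"
    and a c :: "nat \<Rightarrow> complex"
    and F :: "complex set"
    and z :: "nat \<Rightarrow> complex"
  assumes "N \<ge> 1"
    and "has_genus (X0 N) 0 \<or> has_genus (X0 N) 1"
    and "modular_form k N f"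
    and "\<And>w. Im w > 0 \<Longrightarrow> ((\<lambda>n. a n * exp (2 * of_real pi * \<i> * w) ^ n) has_sum f w) {h..}"
    and "a h = 1"
    and "(\<lambda>i. euler_factor (Suc i) (c (Suc i))) has_prod Abs_fps (\<lambda>n. a (h + n))"
    and "fundamental_domain N F"
    and "r \<ge> 1"
    and "{w \<in> F. f w = 0} = z ` {1..r}"
    and "\<And>i j. 1 \<le> i \<Longrightarrow> i \<le> j \<Longrightarrow> j \<le> r \<Longrightarrow> Im (z i) \<le> Im (z j)"
  shows "Omega_inf (\<lambda>m. norm (c m))
           (\<lambda>m. exp (2 * pi * real m * Im (z r)) / real m powr (3 / 2))"
proof (rule ccontr)
  assume notOmega: "\<not> ?thesis"
  define y where "y = Im (z r)"
  define x where "x = exp (2 * pi * y)"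
  define s where "s = exp (2 * of_real pi * \<i> * z r)"
  define g where "g = Abs_fps (\<lambda>n. a (h + n))"
  have "z r \<in> {w \<in> F. f w = 0}" using assms(8,9) by auto
  then have y: "y > 0" and fz: "f (z r) = 0"
    using assms(7) by (auto simp: fundamental_domain_def y_def)
  have x: "x > 1" using y by (simp add: x_def)
  have norm_s: "norm s = 1 / x" by (simp add: s_def x_def y_def exp_minus field_simps)
  have s: "s \<noteq> 0" by (simp add: s_def)
  \<comment> \<open>Every \<open>\<rho>\<close> in \<open>(0, 1)\<close> is the value of
    \<open>q\<close> at a point of the imaginary axis, where the expansion of \<open>f\<close>
    converges.\<close>
  have "ereal 1 \<le> fps_conv_radius g"
    unfolding fps_conv_radius_def
  proof (rule conv_radius_geI_ex')
    fix \<rho> :: real assume \<rho>: "0 < \<rho>" "ereal \<rho> < ereal 1"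
    define w where "w = \<i> * of_real (- ln \<rho> / (2 * pi))"
    have "Im w > 0" using \<rho> by (simp add: w_def divide_neg_pos)
    moreover have "2 * of_real pi * \<i> * w = of_real (ln \<rho>)"
      by (simp add: w_def field_simps)
    then have "exp (2 * of_real pi * \<i> * w) = of_real \<rho>"
      using \<rho> by (simp add: exp_of_real)
    ultimately have "((\<lambda>n. a n * of_real \<rho> ^ n) has_sum f w) {h..}"
      using assms(4)[of w] by simp
    then show "summable (\<lambda>n. fps_nth g n * of_real \<rho> ^ n)"
      using q_expansion_sums[of a "of_real \<rho>" h "f w"] \<rho> by (auto simp: g_def sums_iff)
  qed
  moreover have "norm s < 1" using x by (simp add: norm_s)
  ultimately have conv: "ereal (norm s) < fps_conv_radius g"
    by (meson less_ereal.simps(1) less_le_trans)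
  have zero: "eval_fps g s = 0"
    using q_expansion_sums[of a s h "f (z r)"] assms(4)[of "z r"] y s fz
    by (simp add: s_def y_def g_def eval_fps_def sums_iff)
  have g0: "fps_nth g 0 \<noteq> 0" using assms(5) by (simp add: g_def)
  define v where "v = (\<lambda>n. real n * norm (c n))"
  define B where "B = (\<lambda>n. - sum (\<lambda>d. of_nat d * c d) {d. d dvd n \<and> 0 < n})"
  have eq: "fps_X * fps_deriv g = Abs_fps B * g"
    unfolding B_def
  proof (rule euler_product_log_deriv)
    show "(\<lambda>i. euler_factor (Suc i) (c (Suc i))) has_prod g" using assms(6) by (simp only: g_def)
    show "g \<noteq> 0" using g0 by (metis fps_zero_nth)
  qed
  have exp_x: "exp (2 * pi * real n * Im (z r)) = x ^ n" for n
    by (simp add: x_def y_def mult_ac flip: exp_of_nat_mult)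
  have "(\<lambda>n. v n / x ^ n) \<longlonglongrightarrow> 0"
  proof (rule tendsto_sandwich[OF _ _ tendsto_const])
    \<comment> \<open>The negated claim is applied with the constant \<open>1\<close>.\<close>
    obtain n0 where "finite {n. n > n0 \<and> norm (c n) \<ge> x ^ n / real n powr (3 / 2)}"
      using notOmega unfolding Omega_inf_def exp_x by (auto dest: spec[of _ 1])
    then have "\<forall>\<^sub>F n in sequentially. \<not> (n > n0 \<and> norm (c n) \<ge> x ^ n / real n powr (3 / 2))"
      by (simp add: eventually_cofinite flip: cofinite_eq_sequentially)
    \<comment> \<open>The weight \<open>n\<close> from the logarithmic derivative meets
      \<open>n^(-3/2)\<close> from the assumed bound, and \<open>n^(-1/2)\<close> still tends to
      \<open>0\<close>.\<close>
    then show "\<forall>\<^sub>F n in sequentially. v n / x ^ n \<le> real n powr (- 1 / 2)"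
      using eventually_gt_at_top[of n0] eventually_gt_at_top[of 0]
    proof eventually_elim
      case (elim n)
      then have "real n * norm (c n) \<le> real n * (x ^ n / real n powr (3 / 2))"
        by (intro mult_left_mono) auto
      also have "\<dots> = x ^ n * (real n powr 1 / real n powr (3 / 2))" using elim by simp
      also have "\<dots> = x ^ n * real n powr (- 1 / 2)" by (subst powr_diff[symmetric]) simp
      finally show ?case using x by (simp add: v_def field_simps)
    qed
    show "(\<lambda>n. real n powr (- 1 / 2)) \<longlonglongrightarrow> 0"
      by (rule tendsto_neg_powr) (auto intro: filterlim_real_sequentially)
    show "\<forall>\<^sub>F n in sequentially. 0 \<le> v n / x ^ n" using x by (simp add: v_def)
  qed
  then have lim: "(\<lambda>n. sum v {d. d dvd n \<and> 0 < n} / x ^ n) \<longlonglongrightarrow> 0"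
    by (intro divisor_sum_null x) (simp_all add: v_def)
  \<comment> \<open>Since \<open>norm s = 1 / x\<close>, the triangle inequality passes from
    \<open>B\<close> to the divisor sum of \<open>v\<close>.\<close>
  have le: "norm (B n * s ^ n) \<le> sum v {d. d dvd n \<and> 0 < n} / x ^ n" for n
  proof -
    have "norm (B n) \<le> sum v {d. d dvd n \<and> 0 < n}"
      unfolding B_def norm_minus_cancel by (rule sum_norm_le) (simp add: v_def norm_mult)
    then show ?thesis
      using x by (simp add: norm_mult norm_power norm_s power_one_over divide_simps)
  qed
  have "(\<lambda>n. B n * s ^ n) \<longlonglongrightarrow> 0"
    by (rule Lim_null_comparison[OF _ lim]) (use le in auto)
  then show False
    using log_deriv_coeffs_not_null[OF conv s zero g0 eq] by simp
qed

end
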